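(* Let $\lambda$ be a nonzero real number, $n\ge0$ an integer, and $p(x)\in\mathbb{C}[x]$ a polynomial of degree at most $n$. Then $$p(x)=\sum_{k=0}^{n}C_k\,\phi_{k,\lambda}(x),\qquad\text{where } C_k=\frac{1}{k!}\big\langle(\log_\lambda(1+t))^k\,\big|\,p(x)\big\rangle_\lambda .$$
   Context: For $\lambda\neq 0$: $(x)_{0,\lambda}=1$ and $(x)_{n,\lambda}=x(x-\lambda)\cdots(x-(n-1)\lambda)$ for $n\ge1$. The degenerate exponential is $e_\lambda^{x}(t)=\sum_{k\ge0}(x)_{k,\lambda}\frac{t^k}{k!}=(1+\lambda t)^{x/\lambda}$, $e_\lambda(t)=e_\lambda^1(t)$, and $\log_\lambda$ is its compositional inverse, so $\log_\lambda(1+t)=\frac{1}{\lambda}\big((1+t)^\lambda-1\big)$. For a formal power series $f(t)=\sum_{k\ge0}a_k\frac{t^k}{k!}$ with complex coefficients, $\langle f(t)\,|\,\cdot\,\rangle_\lambda$ denotes the linear functional on $\mathbb{C}[x]$ determined by $\langle f(t)\,|\,(x)_{k,\lambda}\rangle_\lambda=a_k$ for all $k\ge0$. The fully degenerate Bell polynomials $\phi_{n,\lambda}(x)$ are defined by $e_\lambda^{x}\big(e_\lambda(t)-1\big)=\sum_{n\ge0}\phi_{n,\lambda}(x)\frac{t^n}{n!}$. *)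

theory Defs
  imports Complex_Main "HOL-Computational_Algebra.Computational_Algebra"
begin

text \<open>
  All power series are formal. \<open>x\<close> is the indeterminate of \<^typ>\<open>complex poly\<close>, and \<open>t\<close> is the
  variable \<^const>\<open>fps_X\<close> of the power series. The parameter \<open>\<lambda>\<close> is written \<open>lam\<close>.
\<close>

definition deg_falling :: "real \<Rightarrow> nat \<Rightarrow> complex poly" where
  "deg_falling lam n = (\<Prod>i<n. [:- (of_nat i * of_real lam), 1:])"

text \<open>The series \<open>e\<^sub>\<lambda>\<^sup>x(t)\<close> with \<open>x\<close> an indeterminate, so its coefficients are polynomials.\<close>

definition deg_exp_poly :: "real \<Rightarrow> complex poly fps" where
  "deg_exp_poly lam = Abs_fps (\<lambda>k. smult (1 / fact k) (deg_falling lam k))"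

text \<open>The same series with \<open>x\<close> specialized to a number \<open>a\<close>.\<close>

definition deg_exp_at :: "real \<Rightarrow> complex \<Rightarrow> complex fps" where
  "deg_exp_at lam a = Abs_fps (\<lambda>k. poly (deg_falling lam k) a / fact k)"

definition deg_exp :: "real \<Rightarrow> complex fps" where
  "deg_exp lam = deg_exp_at lam 1"

text \<open>
  The series \<open>log\<^sub>\<lambda>(1 + t)\<close> in \<open>t\<close>: since \<open>log\<^sub>\<lambda>\<close> inverts \<open>e\<^sub>\<lambda>\<close>, it is the compositional inverse of
  the series \<open>e\<^sub>\<lambda>(t) - 1\<close>, whose constant coefficient is 0. Its closed form is
  \<open>deg_log1p_closed_form\<close> below.
\<close>

definition deg_log1p :: "real \<Rightarrow> complex fps" where
  "deg_log1p lam = fps_inv (deg_exp lam - 1)"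

text \<open>
  \<open>fps_const_coeffs\<close> views a complex power series as one over \<^typ>\<open>complex poly\<close>, which is needed to
  substitute \<open>e\<^sub>\<lambda>(t) - 1\<close> into \<open>e\<^sub>\<lambda>\<^sup>x\<close>.
\<close>

definition fps_const_coeffs :: "complex fps \<Rightarrow> complex poly fps" where
  "fps_const_coeffs f = Abs_fps (\<lambda>k. [:fps_nth f k:])"

definition deg_bell :: "real \<Rightarrow> nat \<Rightarrow> complex poly" where
  "deg_bell lam n =
     smult (fact n) (fps_nth (deg_exp_poly lam oo fps_const_coeffs (deg_exp lam - 1)) n)"

text \<open>
  For \<open>f(t) = \<Sum>k. a\<^sub>k t\<^sup>k / k!\<close> one has \<open>a\<^sub>k = k! * fps_nth f k\<close>. Existence and uniqueness of the
  described functional are shown in \<open>deg_functional_ex1\<close>.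
\<close>

definition deg_functional :: "real \<Rightarrow> complex fps \<Rightarrow> complex poly \<Rightarrow> complex" where
  "deg_functional lam f =
     (THE L. Vector_Spaces.linear smult (*) L \<and>
             (\<forall>k. L (deg_falling lam k) = fact k * fps_nth f k))"

lemma deg_falling_0 [simp]: "deg_falling lam 0 = 1"
  by (simp add: deg_falling_def)

lemma deg_falling_Suc:
  "deg_falling lam (Suc n) = deg_falling lam n * [:- (of_nat n * of_real lam), 1:]"
  by (simp add: deg_falling_def)

lemma deg_falling_nz [simp]: "deg_falling lam n \<noteq> 0"
  by (simp add: deg_falling_def)

lemma degree_deg_falling [simp]: "degree (deg_falling lam n) = n"
  by (induction n) (simp_all add: deg_falling_Suc degree_mult_eq del: mult_pCons_right)

lemma lead_coeff_deg_falling [simp]: "coeff (deg_falling lam n) n = 1"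
proof -
  have "lead_coeff (deg_falling lam n) = 1"
    by (simp add: deg_falling_def lead_coeff_prod)
  then show ?thesis by simp
qed

lemma linear_poly_functional_iff:
  "Vector_Spaces.linear smult (*) (L :: complex poly \<Rightarrow> complex) \<longleftrightarrow>
     (\<forall>p q. L (p + q) = L p + L q) \<and> (\<forall>c p. L (smult c p) = c * L p)"
proof -
  have 1: "module (smult :: complex \<Rightarrow> complex poly \<Rightarrow> complex poly)"
    by unfold_locales (simp_all add: smult_add_left smult_add_right)
  have 2: "module ((*) :: complex \<Rightarrow> complex \<Rightarrow> complex)"
    by unfold_locales (simp_all add: algebra_simps)
  show ?thesis
    using 1 2 unfolding linear_iff_module_hom module_hom_def module_hom_axioms_def by auto
qed

text \<open>The value that the functional with \<open>L (deg_falling lam k) = k! * fps_nth f k\<close> takes on \<open>x\<^sup>n\<close>.\<close>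

fun deg_moment :: "real \<Rightarrow> complex fps \<Rightarrow> nat \<Rightarrow> complex" where
  "deg_moment lam f n =
     fact n * fps_nth f n - (\<Sum>i<n. coeff (deg_falling lam n) i * deg_moment lam f i)"

declare deg_moment.simps [simp del]

lemma deg_functional_unique:
  assumes L: "Vector_Spaces.linear smult (*) L" "\<And>k. L (deg_falling lam k) = a k"
    and M: "Vector_Spaces.linear smult (*) M" "\<And>k. M (deg_falling lam k) = a k"
  shows "L p = (M p :: complex)"
proof (induction "degree p" arbitrary: p rule: less_induct)
  case less
  define c q where "c = lead_coeff p" and "q = p - smult c (deg_falling lam (degree p))"
  have p: "p = q + smult c (deg_falling lam (degree p))"
    by (simp add: q_def)
  have zero: "L 0 = 0" "M 0 = 0"
    using L(1) M(1) unfolding linear_poly_functional_iff by (metis add_cancel_left_left)+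
  have "L q = M q"
  proof (cases "degree p = 0")
    case True
    then have "p = [:c:]" unfolding c_def by (metis degree_eq_zeroE lead_coeff_pCons(2) pCons_0_0)
    then have "q = 0" by (simp add: q_def True)
    then show ?thesis by (simp add: zero)
  next
    case False
    have "degree q \<le> degree p"
      unfolding q_def by (intro degree_diff_le) (auto intro: order.trans[OF degree_smult_le])
    moreover have "coeff q (degree p) = 0"
      by (simp add: q_def c_def)
    ultimately have "degree q < degree p"
      using False by (metis degree_0 leading_coeff_0_iff le_neq_implies_less neq0_conv)
    then show ?thesis by (rule less)
  qed
  with p L M show ?case
    unfolding linear_poly_functional_iff by metis
qed

lemma deg_functional_ex1:
  "\<exists>!L :: complex poly \<Rightarrow> complex. Vector_Spaces.linear smult (*) L \<and>
     (\<forall>k. L (deg_falling lam k) = fact k * fps_nth f k)"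
proof (rule ex_ex1I)
  define L where "L p = (\<Sum>i\<le>degree p. coeff p i * deg_moment lam f i)" for p
  have L: "L p = (\<Sum>i\<le>m. coeff p i * deg_moment lam f i)" if "degree p \<le> m" for p m
    unfolding L_def using that
    by (intro sum.mono_neutral_left) (auto simp: coeff_eq_0)
  have "L (p + q) = L p + L q" for p q
    using L[of p "max (degree p) (degree q)"] L[of q "max (degree p) (degree q)"]
      L[of "p + q" "max (degree p) (degree q)"] degree_add_le_max[of p q]
    by (simp add: sum.distrib algebra_simps)
  moreover have "L (smult c p) = c * L p" for c p
    using L[of "smult c p" "degree p"] L[of p "degree p"] degree_smult_le[of c p]
    by (simp add: sum_distrib_left algebra_simps)
  moreover have "L (deg_falling lam k) = fact k * fps_nth f k" for k
    unfolding L_def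
    by (subst lessThan_Suc_atMost[symmetric]) (simp add: deg_moment.simps[of _ _ k])
  ultimately show "\<exists>L. Vector_Spaces.linear smult (*) L \<and>
      (\<forall>k. L (deg_falling lam k) = fact k * fps_nth f k)"
    unfolding linear_poly_functional_iff by blast
next
  fix L M :: "complex poly \<Rightarrow> complex"
  assume "Vector_Spaces.linear smult (*) L \<and> (\<forall>k. L (deg_falling lam k) = fact k * fps_nth f k)"
    "Vector_Spaces.linear smult (*) M \<and> (\<forall>k. M (deg_falling lam k) = fact k * fps_nth f k)"
  then show "L = M"
    using deg_functional_unique[of L lam "\<lambda>k. fact k * fps_nth f k" M] by blast
qed

lemma linear_deg_functional: "Vector_Spaces.linear smult (*) (deg_functional lam f)"
  and deg_functional_deg_falling: "deg_functional lam f (deg_falling lam k) = fact k * fps_nth f k"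
  using theI'[OF deg_functional_ex1[of lam f]] unfolding deg_functional_def by blast+

lemma poly_deg_bell:
  "poly (deg_bell lam n) a = fact n * fps_nth (deg_exp_at lam a oo (deg_exp lam - 1)) n"
proof -
  have pow: "fps_nth (fps_const_coeffs f ^ i) k = [:fps_nth (f ^ i) k:]" for f i k
  proof (induction i arbitrary: k)
    case 0
    then show ?case by (cases k) (simp_all add: one_pCons)
  next
    case (Suc i)
    have sum_const: "(\<Sum>j\<in>A. [:g j:]) = [:\<Sum>j\<in>A. g j:]" for A :: "nat set" and g :: "nat \<Rightarrow> complex"
      by (induction A rule: infinite_finite_induct) simp_all
    show ?case
      by (simp only: power_Suc fps_mult_nth Suc) (simp add: fps_const_coeffs_def sum_const mult.commute)
  qed
  show ?thesis
    by (simp add: deg_bell_def fps_compose_nth pow poly_sum deg_exp_poly_def deg_exp_at_def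
        mult_ac)
qed

lemma deg_exp_at_closed_form:
  assumes "lam \<noteq> 0"
  shows "deg_exp_at lam a = fps_binomial (a / of_real lam) oo (fps_const (of_real lam) * fps_X)"
proof -
  have "poly (deg_falling lam k) a = of_real lam ^ k * (\<Prod>i<k. a / of_real lam - of_nat i)" for k
    by (induction k) (use assms in \<open>simp_all add: deg_falling_Suc field_simps\<close>)
  then show ?thesis
    by (simp add: fps_eq_iff fps_compose_linear deg_exp_at_def gbinomial_prod_rev atLeast0LessThan)
qed

lemma deg_exp_minus_1_nth: "fps_nth (deg_exp lam - 1) 0 = 0" "fps_nth (deg_exp lam - 1) 1 = 1"
  by (simp_all add: deg_exp_def deg_exp_at_def deg_falling_def)

lemma deg_log1p_closed_form:
  assumes "lam \<noteq> 0"
  shows "deg_log1p lam = fps_const (1 / of_real lam) * (fps_binomial (of_real lam) - 1)"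
proof -
  define l where "l = complex_of_real lam"
  have l: "l \<noteq> 0" using assms by (simp add: l_def)
  define B where "B = fps_binomial (1 / l)"
  define h where "h = fps_binomial l - 1"
  define g where "g = fps_const (1 / l) * h"
  have h0: "fps_nth h 0 = 0" and g0: "fps_nth g 0 = 0"
    by (simp_all add: h_def g_def)
  have lg: "(fps_const l * fps_X) oo g = h"
    using l g0 by (simp add: g_def fps_compose_mult_distrib mult.assoc[symmetric])
  have "deg_exp lam oo g = B oo h"
    unfolding deg_exp_def deg_exp_at_closed_form[OF assms] B_def l_def[symmetric]
    using fps_compose_assoc[OF g0, of "fps_const l * fps_X" "fps_binomial (1 / l)"] by (simp add: lg)
  moreover have "B oo h = 1 + fps_X"
  proof -
    have u: "fps_nth (1 + fps_X :: complex fps) 0 \<noteq> 0" by simp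
    have dB: "fps_deriv B * (1 + fps_X) = fps_const (1 / l) * B"
      by (simp add: B_def fps_binomial_deriv fps_divide_unit mult.assoc inverse_mult_eq_1)
    have "(fps_deriv B * (1 + fps_X)) oo h = (fps_deriv B oo h) * fps_binomial l"
      by (simp add: fps_compose_mult_distrib[OF h0] fps_compose_add_distrib h0) (simp add: h_def)
    then have dBh: "(fps_deriv B oo h) * fps_binomial l = fps_const (1 / l) * (B oo h)"
      by (simp add: dB fps_compose_mult_distrib[OF h0])
    have dh: "fps_deriv h = fps_const l * fps_binomial l / (1 + fps_X)"
      by (simp add: h_def fps_binomial_deriv)
    have "fps_deriv (B oo h) = (fps_deriv B oo h) * fps_binomial l * fps_const l / (1 + fps_X)"
      by (simp add: fps_compose_deriv[OF h0] dh fps_divide_unit mult_ac)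
    also have "(fps_deriv B oo h) * fps_binomial l * fps_const l = fps_const 1 * (B oo h)"
    proof -
      have "fps_const (1 / l) * (B oo h) * fps_const l = (fps_const (1 / l) * fps_const l) * (B oo h)"
        by (rule mult.commute[THEN trans], subst mult.assoc[symmetric]) (simp only: mult.commute)
      then show ?thesis unfolding dBh using l by simp
    qed
    finally have "fps_deriv (B oo h) = fps_const 1 * (B oo h) / (1 + fps_X)" .
    moreover have "fps_nth (B oo h) 0 = 1" by (simp add: B_def)
    ultimately have "B oo h = fps_binomial 1"
      using fps_binomial_ODE_unique'[of "B oo h" 1] by blast
    also have "\<dots> = 1 + fps_X" using fps_binomial_of_nat[of 1] by simp
    finally show ?thesis .
  qed
  ultimately have E: "(deg_exp lam - 1) oo g = fps_X"
    by (simp add: fps_compose_sub_distrib)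
  have d1: "fps_nth (deg_exp lam - 1) 1 \<noteq> 0"
    by (subst deg_exp_minus_1_nth) simp
  have "deg_log1p lam = deg_log1p lam oo ((deg_exp lam - 1) oo g)"
    by (simp add: E)
  also have "\<dots> = (deg_log1p lam oo (deg_exp lam - 1)) oo g"
    by (rule fps_compose_assoc[OF g0 deg_exp_minus_1_nth(1)])
  also have "\<dots> = fps_X oo g"
    unfolding deg_log1p_def by (subst fps_inv[OF deg_exp_minus_1_nth(1) d1]) simp
  also have "\<dots> = g"
    using g0 by (simp add: fps_eq_iff fps_X_fps_compose)
  finally show ?thesis by (simp add: g_def h_def l_def)
qed

end

theory Submission
  imports Defs
begin

text \<open>
  Composing \<open>e\<^sub>\<lambda>\<^sup>x(e\<^sub>\<lambda>(t) - 1)\<close> with \<open>log\<^sub>\<lambda>(1 + t)\<close> gives back \<open>e\<^sub>\<lambda>\<^sup>x(t)\<close>. Comparing coefficients of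
  \<open>t\<^sup>m\<close> is exactly the claim for the polynomial \<open>(x)\<^sub>m\<^sub>,\<^sub>\<lambda>\<close>. Both sides are linear in \<open>p\<close>, and the
  degenerate falling factorials of index at most \<open>n\<close> span the polynomials of degree at most \<open>n\<close>.
\<close>

text \<open>Each \<open>deg_falling lam m\<close> is monic of degree \<open>m\<close>, so
  subtracting a multiple of the top one lowers the degree bound by one.\<close>

lemma deg_falling_expansion:
  assumes "degree p \<le> n"
  obtains c where "p = (\<Sum>m\<le>n. smult (c m) (deg_falling lam m))"
  using assms
proof (induction n arbitrary: p thesis)
  case 0
  then obtain a where "p = [:a:]"
    by (auto elim: degree_eq_zeroE)
  then show ?case
    using "0.prems"(1)[of "\<lambda>_. a"] by simp
next
  case (Suc n)
  \<comment> \<open>The coefficient at \<open>Suc n\<close>, not the leading one: it is 0 when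
    \<open>p\<close> has smaller degree.\<close>
  define a where "a = coeff p (Suc n)"
  define q where "q = p - smult a (deg_falling lam (Suc n))"
  have "degree q \<le> n"
  proof (rule degree_le, intro allI impI)
    fix i assume "i > n"
    show "coeff q i = 0"
    proof (cases "i = Suc n")
      case True
      then show ?thesis by (simp add: q_def a_def)
    next
      case False
      with \<open>i > n\<close> Suc.prems(2) show ?thesis
        by (simp add: q_def coeff_eq_0)
    qed
  qed
  then obtain c where c: "q = (\<Sum>m\<le>n. smult (c m) (deg_falling lam m))"
    using Suc.IH by blast
  have "p = q + smult a (deg_falling lam (Suc n))"
    by (simp add: q_def)
  also have "\<dots> = (\<Sum>m\<le>Suc n. smult ((c(Suc n := a)) m) (deg_falling lam m))"
    by (simp add: c)
  finally show ?case
    by (rule Suc.prems(1))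
qed

lemma deg_functional_add:
  "deg_functional lam f (p + q) = deg_functional lam f p + deg_functional lam f q"
  using linear_deg_functional unfolding linear_poly_functional_iff by blast

lemma deg_functional_smult:
  "deg_functional lam f (smult c p) = c * deg_functional lam f p"
  using linear_deg_functional unfolding linear_poly_functional_iff by blast

lemma deg_functional_sum:
  "deg_functional lam f (sum g A) = (\<Sum>i\<in>A. deg_functional lam f (g i))"
proof -
  \<comment> \<open>Sums over empty and infinite index sets are 0.\<close>
  have "deg_functional lam f 0 = 0"
    using deg_functional_smult[of lam f 0 0] by simp
  then show ?thesis
    by (induction A rule: infinite_finite_induct) (simp_all add: deg_functional_add)
qed

lemma deg_log1p_nth_0 [simp]: "fps_nth (deg_log1p lam) 0 = 0"
  by (simp add: deg_log1p_def fps_inv_def)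

lemma deg_exp_minus_1_compose_log1p: "(deg_exp lam - 1) oo deg_log1p lam = fps_X"
  unfolding deg_log1p_def
  by (rule fps_inv_right[OF deg_exp_minus_1_nth(1)]) (subst deg_exp_minus_1_nth(2), simp)

text \<open>By \<open>poly_deg_bell\<close> the series with the Bell coefficients is
  \<open>deg_exp_at lam a oo (deg_exp lam - 1)\<close>; associativity of composition then cancels
  the logarithm against \<open>deg_exp lam - 1\<close>.\<close>

lemma deg_exp_at_conv_deg_bell:
  "deg_exp_at lam a = Abs_fps (\<lambda>k. poly (deg_bell lam k) a / fact k) oo deg_log1p lam"
proof -
  have "deg_exp_at lam a = deg_exp_at lam a oo ((deg_exp lam - 1) oo deg_log1p lam)"
    by (simp add: deg_exp_minus_1_compose_log1p)
  also have "\<dots> = (deg_exp_at lam a oo (deg_exp lam - 1)) oo deg_log1p lam"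
    by (rule fps_compose_assoc[OF deg_log1p_nth_0 deg_exp_minus_1_nth(1)])
  also have "deg_exp_at lam a oo (deg_exp lam - 1) = Abs_fps (\<lambda>k. poly (deg_bell lam k) a / fact k)"
    by (simp add: fps_eq_iff poly_deg_bell)
  finally show ?thesis .
qed

text \<open>The upper limit \<open>n\<close> instead of \<open>m\<close> gives all
  \<open>m \<le> n\<close> the same range, so that the sums over \<open>m\<close> and
  \<open>k\<close> can be exchanged later.\<close>

lemma deg_falling_conv_deg_bell:
  assumes "m \<le> n"
  shows "deg_falling lam m =
    (\<Sum>k=0..n. smult (1 / fact k * deg_functional lam (deg_log1p lam ^ k) (deg_falling lam m))
      (deg_bell lam k))"
\<comment> \<open>A complex polynomial is determined by its values, so series with scalar
  coefficients suffice.\<close>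
proof (rule poly_eq_poly_eq_iff[THEN iffD1], rule ext)
  fix a
  have "poly (deg_falling lam m) a = fact m * fps_nth (deg_exp_at lam a) m"
    by (simp add: deg_exp_at_def)
  also have "\<dots> = (\<Sum>k=0..m. fact m *
      (poly (deg_bell lam k) a / fact k * fps_nth (deg_log1p lam ^ k) m))"
    by (subst deg_exp_at_conv_deg_bell) (simp add: fps_compose_nth sum_distrib_left)
  \<comment> \<open>\<open>deg_log1p lam ^ k\<close> has no terms of degree below \<open>k\<close>,
    so the added summands with \<open>k > m\<close> vanish.\<close>
  also have "\<dots> = (\<Sum>k=0..n. fact m *
      (poly (deg_bell lam k) a / fact k * fps_nth (deg_log1p lam ^ k) m))"
    using assms
    by (intro sum.mono_neutral_left) (auto simp: startsby_zero_power_prefix)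
  finally show "poly (deg_falling lam m) a = poly (\<Sum>k=0..n.
      smult (1 / fact k * deg_functional lam (deg_log1p lam ^ k) (deg_falling lam m))
        (deg_bell lam k)) a"
    by (simp add: poly_sum deg_functional_deg_falling mult_ac)
qed

lemma smult_sum_right: "smult a (sum f A) = (\<Sum>i\<in>A. smult a (f i))"
  by (induction A rule: infinite_finite_induct) (simp_all add: smult_add_right)

theorem theorem4:
  fixes lam :: real and n :: nat and p :: "complex poly"
  assumes "lam \<noteq> 0" and "degree p \<le> n"
  shows "p = (\<Sum>k=0..n. smult (1 / fact k * deg_functional lam (deg_log1p lam ^ k) p) (deg_bell lam k))"
proof -
  let ?C = "\<lambda>k q. 1 / fact k * deg_functional lam (deg_log1p lam ^ k) q"
  obtain c where c: "p = (\<Sum>m\<le>n. smult (c m) (deg_falling lam m))"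
    using deg_falling_expansion[OF assms(2)] .
  \<comment> \<open>After the exchange of sums, this reassembles the inner sum over \<open>m\<close>
    into the coefficient for \<open>p\<close>.\<close>
  have C: "?C k p = (\<Sum>m\<le>n. c m * ?C k (deg_falling lam m))" for k
    by (simp add: c deg_functional_sum deg_functional_smult sum_distrib_left mult_ac
        sum_divide_distrib)
  have "p = (\<Sum>m\<le>n. smult (c m)
      (\<Sum>k=0..n. smult (?C k (deg_falling lam m)) (deg_bell lam k)))"
    by (subst c, intro sum.cong refl arg_cong[where f = "smult _"] deg_falling_conv_deg_bell) simp
  also have "\<dots> = (\<Sum>m\<le>n. \<Sum>k=0..n. smult (c m * ?C k (deg_falling lam m)) (deg_bell lam k))"
    by (simp only: smult_sum_right smult_smult)
  also have "\<dots> = (\<Sum>k=0..n. \<Sum>m\<le>n. smult (c m * ?C k (deg_falling lam m)) (deg_bell lam k))"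
    by (rule sum.swap)
  also have "\<dots> = (\<Sum>k=0..n. smult (?C k p) (deg_bell lam k))"
    by (simp only: C smult_sum)
  finally show ?thesis .
qed

end
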